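(* Let $G$ be a finite simple graph, and suppose that $G_1$ and $G_2$ form a splitting of $G$ along an edge $e$. If $G_1$ is bipartite, then $I_G=I_{G_1}+I_{G_2}$.
   Context: $\mathbb{K}$ is an algebraically closed field of characteristic zero. For a finite simple graph $G$ with vertices $V(G)=\{x_1,\ldots,x_n\}$ and edges $E(G)=\{e_1,\ldots,e_q\}$, the toric ideal $I_G$ is the kernel of the $\mathbb{K}$-algebra homomorphism $\mathbb{K}[E(G)]=\mathbb{K}[e_1,\ldots,e_q]\to\mathbb{K}[x_1,\ldots,x_n]$ sending $e_i=\{x_{i,1},x_{i,2}\}$ to $x_{i,1}x_{i,2}$. For a subgraph $G_i$ of $G$, $I_{G_i}$ is viewed as an ideal of $\mathbb{K}[E(G)]$ (by extension). Splitting: let $W_1,W_2\subseteq V(G)$ with $W_1\cup W_2=V(G)$, let $G_i$ be the induced subgraph of $G$ on $W_i$, let $Y=W_1\cap W_2$ and let $H$ be the induced subgraph on $Y$. Then $G_1$ and $G_2$ form a splitting of $G$ along $H$ if removing the vertices $Y$ from $G$ yields two disconnected pieces, i.e. no edge of $G$ joins a vertex of $W_1\setminus Y$ to a vertex of $W_2\setminus Y$. It is a splitting along an edge $e$ if $H$ consists of the single edge $e$ and its two endpoints. *)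

theory Defs
  imports
    "HOL-Library.Poly_Mapping"
    "HOL-Computational_Algebra.Polynomial"
    "HOL-Algebra.Ideal"
    "HOL-Algebra.RingHom"
begin

section \<open>Finite simple graphs\<close>

record 'v ugraph =
  verts :: "'v set"
  edges :: "'v set set"

definition simple_graph :: "'v ugraph \<Rightarrow> bool" where
  "simple_graph G \<longleftrightarrow> finite (verts G) \<and> (\<forall>e\<in>edges G. e \<subseteq> verts G \<and> card e = 2)"

definition induced :: "'v ugraph \<Rightarrow> 'v set \<Rightarrow> 'v ugraph" where
  "induced G W = \<lparr>verts = W, edges = {e \<in> edges G. e \<subseteq> W}\<rparr>"

definition bipartite :: "'v ugraph \<Rightarrow> bool" where
  "bipartite G \<longleftrightarrow> (\<exists>A B. A \<union> B = verts G \<and> A \<inter> B = {} \<and>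
     (\<forall>e\<in>edges G. \<exists>a\<in>A. \<exists>b\<in>B. e = {a, b}))"

text \<open>The sets \<open>W1 - W2\<close> and \<open>W2 - W1\<close> are the parts left when \<open>W1 \<inter> W2\<close> is removed.
  They are allowed to be empty.\<close>

definition splitting_along :: "'v ugraph \<Rightarrow> 'v ugraph \<Rightarrow> 'v ugraph \<Rightarrow> 'v ugraph \<Rightarrow> bool" where
  "splitting_along G G1 G2 H \<longleftrightarrow> (\<exists>W1 W2.
     W1 \<subseteq> verts G \<and> W2 \<subseteq> verts G \<and> W1 \<union> W2 = verts G \<and>
     G1 = induced G W1 \<and> G2 = induced G W2 \<and> H = induced G (W1 \<inter> W2) \<and>
     (\<forall>u \<in> W1 - W1 \<inter> W2. \<forall>w \<in> W2 - W1 \<inter> W2. {u, w} \<notin> edges G))"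

definition splitting_along_edge :: "'v ugraph \<Rightarrow> 'v ugraph \<Rightarrow> 'v ugraph \<Rightarrow> 'v set \<Rightarrow> bool" where
  "splitting_along_edge G G1 G2 e \<longleftrightarrow>
     e \<in> edges G \<and> splitting_along G G1 G2 \<lparr>verts = e, edges = {e}\<rparr>"

section \<open>Polynomial rings and toric ideals\<close>

text \<open>A polynomial maps each exponent vector to its coefficient. The type has every element of
  \<open>'x\<close> as a variable, and \<open>poly_ring X\<close> is the subring of polynomials in the variables \<open>X\<close>.\<close>

type_synonym ('x, 'k) mpoly = "('x \<Rightarrow>\<^sub>0 nat) \<Rightarrow>\<^sub>0 'k"

definition poly_ring :: "'x set \<Rightarrow> ('x, 'k::comm_ring_1) mpoly ring" where
  "poly_ring X = \<lparr>carrier = {p. \<forall>m \<in> Poly_Mapping.keys p. Poly_Mapping.keys m \<subseteq> X},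
     mult = (*), one = 1, zero = 0, add = (+)\<rparr>"

definition Const :: "'k \<Rightarrow> ('x, 'k::comm_ring_1) mpoly" where
  "Const c = Poly_Mapping.single 0 c"

definition Var :: "'x \<Rightarrow> ('x, 'k::comm_ring_1) mpoly" where
  "Var x = Poly_Mapping.single (Poly_Mapping.single x 1) 1"

definition poly_subst :: "('x \<Rightarrow> ('y, 'k) mpoly) \<Rightarrow> ('x, 'k::comm_ring_1) mpoly \<Rightarrow> ('y, 'k) mpoly" where
  "poly_subst f p = (\<Sum>m \<in> Poly_Mapping.keys p.
     Const (Poly_Mapping.lookup p m) *
     (\<Prod>x \<in> Poly_Mapping.keys m. f x ^ Poly_Mapping.lookup m x))"

definition toric_hom :: "('v set, 'k::comm_ring_1) mpoly \<Rightarrow> ('v, 'k) mpoly" where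
  "toric_hom = poly_subst (\<lambda>e. \<Prod>v\<in>e. Var v)"

definition toric_ideal :: "'v ugraph \<Rightarrow> ('v set, 'k::comm_ring_1) mpoly set" where
  "toric_ideal G = a_kernel (poly_ring (edges G)) (poly_ring (verts G)) toric_hom"

text \<open>For a subgraph \<open>H\<close> of \<open>G\<close>, the extension of the toric ideal of \<open>H\<close> to the edge ring
  of \<open>G\<close>.\<close>

definition toric_ideal_in :: "'v ugraph \<Rightarrow> 'v ugraph \<Rightarrow> ('v set, 'k::comm_ring_1) mpoly set" where
  "toric_ideal_in G H = genideal (poly_ring (edges G)) (toric_ideal H)"

section \<open>Basic facts\<close>

lemma cring_poly_ring: "cring (poly_ring X :: ('x, 'k::comm_ring_1) mpoly ring)"
proof (rule cringI)
  show "abelian_group (poly_ring X :: ('x, 'k) mpoly ring)"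
  proof (rule abelian_groupI)
    fix p assume "p \<in> carrier (poly_ring X :: ('x, 'k) mpoly ring)"
    then have "- p \<in> carrier (poly_ring X :: ('x, 'k) mpoly ring)"
      by (auto simp: poly_ring_def)
    then show "\<exists>q\<in>carrier (poly_ring X :: ('x, 'k) mpoly ring). q \<oplus>\<^bsub>poly_ring X\<^esub> p = \<zero>\<^bsub>poly_ring X\<^esub>"
      by (intro bexI[of _ "- p"]) (auto simp: poly_ring_def)
  next
    fix p q assume "p \<in> carrier (poly_ring X :: ('x, 'k) mpoly ring)"
      "q \<in> carrier (poly_ring X :: ('x, 'k) mpoly ring)"
    then show "p \<oplus>\<^bsub>poly_ring X\<^esub> q \<in> carrier (poly_ring X)"
      using Poly_Mapping.keys_add[of p q] by (auto simp: poly_ring_def)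
  qed (simp_all add: poly_ring_def add_ac)
  show "comm_monoid (poly_ring X :: ('x, 'k) mpoly ring)"
  proof (rule comm_monoidI)
    fix p q assume "p \<in> carrier (poly_ring X :: ('x, 'k) mpoly ring)"
      "q \<in> carrier (poly_ring X :: ('x, 'k) mpoly ring)"
    then have pq: "Poly_Mapping.keys a \<subseteq> X" "Poly_Mapping.keys b \<subseteq> X"
      if "a \<in> Poly_Mapping.keys p" "b \<in> Poly_Mapping.keys q" for a b
      using that by (auto simp: poly_ring_def)
    have "Poly_Mapping.keys m \<subseteq> X" if "m \<in> Poly_Mapping.keys (p * q)" for m
    proof -
      from that keys_mult[of p q] obtain a b where "m = a + b"
        "a \<in> Poly_Mapping.keys p" "b \<in> Poly_Mapping.keys q" by blast
      then show ?thesis using pq[of a b] Poly_Mapping.keys_add[of a b] by blast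
    qed
    then show "p \<otimes>\<^bsub>poly_ring X\<^esub> q \<in> carrier (poly_ring X)"
      by (simp add: poly_ring_def)
  qed (simp_all add: poly_ring_def mult_ac)
qed (simp add: poly_ring_def distrib_right)

lemma poly_subst_superset:
  assumes "finite S" "Poly_Mapping.keys p \<subseteq> S"
  shows "poly_subst f p = (\<Sum>m\<in>S. Const (Poly_Mapping.lookup p m) *
     (\<Prod>x \<in> Poly_Mapping.keys m. f x ^ Poly_Mapping.lookup m x))"
  unfolding poly_subst_def
  by (rule sum.mono_neutral_left) (use assms in \<open>auto simp: Const_def in_keys_iff\<close>)

lemma poly_subst_add: "poly_subst f (p + q) = poly_subst f p + poly_subst f q"
proof -
  let ?S = "Poly_Mapping.keys p \<union> Poly_Mapping.keys q"
  have "Poly_Mapping.keys (p + q) \<subseteq> ?S" by (rule Poly_Mapping.keys_add)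
  then show ?thesis
    by (simp add: poly_subst_superset[of ?S] lookup_add Const_def single_add distrib_right
        sum.distrib)
qed

lemma poly_subst_Const [simp]: "poly_subst f (Const c) = Const c"
  by (simp add: poly_subst_def Const_def)

lemma poly_subst_Var [simp]: "poly_subst f (Var x) = f x"
  by (simp add: poly_subst_def Const_def Var_def)

lemma monom_power_add:
  fixes f :: "'x \<Rightarrow> 'a::comm_monoid_mult"
  shows "(\<Prod>x \<in> Poly_Mapping.keys (a + b). f x ^ Poly_Mapping.lookup (a + b) x) =
    (\<Prod>x \<in> Poly_Mapping.keys a. f x ^ Poly_Mapping.lookup a x) *
    (\<Prod>x \<in> Poly_Mapping.keys b. f x ^ Poly_Mapping.lookup b x)"
proof -
  let ?S = "Poly_Mapping.keys a \<union> Poly_Mapping.keys b"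
  have *: "(\<Prod>x \<in> Poly_Mapping.keys c. f x ^ Poly_Mapping.lookup c x) =
      (\<Prod>x \<in> ?S. f x ^ Poly_Mapping.lookup c x)" if "Poly_Mapping.keys c \<subseteq> ?S" for c
    by (rule prod.mono_neutral_left) (use that in \<open>auto simp: in_keys_iff\<close>)
  have "Poly_Mapping.keys (a + b) \<subseteq> ?S" by (rule Poly_Mapping.keys_add)
  then show ?thesis
    unfolding *[OF \<open>Poly_Mapping.keys (a + b) \<subseteq> ?S\<close>] *[OF Un_upper1] *[OF Un_upper2]
    by (simp add: lookup_add power_add prod.distrib)
qed

lemma poly_subst_single: "poly_subst f (Poly_Mapping.single m c) =
    Const c * (\<Prod>x \<in> Poly_Mapping.keys m. f x ^ Poly_Mapping.lookup m x)"
  by (simp add: poly_subst_def Const_def)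

lemma Const_mult: "Const (c * d) = Const c * Const d"
  by (simp add: Const_def mult_single)

lemma poly_subst_mult_single:
  "poly_subst f (Poly_Mapping.single a c * Poly_Mapping.single b d) =
   poly_subst f (Poly_Mapping.single a c) * poly_subst f (Poly_Mapping.single b d)"
  by (simp add: mult_single poly_subst_single monom_power_add Const_mult mult_ac)

lemma poly_subst_zero [simp]: "poly_subst f 0 = 0"
  by (simp add: poly_subst_def)

lemma poly_subst_sum: "poly_subst f (sum g A) = (\<Sum>a\<in>A. poly_subst f (g a))"
  by (induction A rule: infinite_finite_induct) (auto simp: poly_subst_add)

lemma mpoly_sum_single:
  "p = (\<Sum>m \<in> Poly_Mapping.keys p. Poly_Mapping.single m (Poly_Mapping.lookup p m))"
  by (rule poly_mapping_eqI) (auto simp: lookup_sum lookup_single when_def in_keys_iff)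

lemma poly_subst_mult: "poly_subst f (p * q) = poly_subst f p * poly_subst f q"
proof -
  define P where "P = (\<lambda>m. Poly_Mapping.single m (Poly_Mapping.lookup p m))"
  define Q where "Q = (\<lambda>m. Poly_Mapping.single m (Poly_Mapping.lookup q m))"
  have p: "p = sum P (Poly_Mapping.keys p)" and q: "q = sum Q (Poly_Mapping.keys q)"
    unfolding P_def Q_def by (rule mpoly_sum_single)+
  have "poly_subst f (sum P A * sum Q B) = poly_subst f (sum P A) * poly_subst f (sum Q B)" for A B
    by (simp add: P_def Q_def sum_product poly_subst_sum poly_subst_mult_single)
  from this[of "Poly_Mapping.keys p" "Poly_Mapping.keys q", folded p q] show ?thesis .
qed

lemma toric_hom_Var: "u \<noteq> v \<Longrightarrow> toric_hom (Var {u, v}) = Var u * Var v"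
  by (simp add: toric_hom_def)

lemma toric_hom_ring_hom:
  assumes "simple_graph G"
  shows "toric_hom \<in> ring_hom (poly_ring (edges G))
           (poly_ring (verts G) :: ('v, 'k::comm_ring_1) mpoly ring)"
proof (rule ring_hom_memI)
  let ?R = "poly_ring (verts G) :: ('v, 'k) mpoly ring"
  interpret R: cring ?R by (rule cring_poly_ring)
  have zero_closed: "0 \<in> carrier ?R"
    by (simp add: poly_ring_def)
  have a_closed: "p + q \<in> carrier ?R" if "p \<in> carrier ?R" "q \<in> carrier ?R" for p q
    using R.a_closed[OF that] by (simp add: poly_ring_def)
  have m_closed: "p * q \<in> carrier ?R" if "p \<in> carrier ?R" "q \<in> carrier ?R" for p q
    using R.m_closed[OF that] by (simp add: poly_ring_def)
  have sum_closed: "(\<Sum>a\<in>A. g a) \<in> carrier ?R" if "\<And>a. a \<in> A \<Longrightarrow> g a \<in> carrier ?R" for A :: "'b set" and g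
    using that by (induction A rule: infinite_finite_induct) (auto intro: a_closed zero_closed)
  have one_closed: "1 \<in> carrier ?R"
    by (simp add: poly_ring_def)
  have prod_closed: "(\<Prod>a\<in>A. g a) \<in> carrier ?R" if "\<And>a. a \<in> A \<Longrightarrow> g a \<in> carrier ?R" for A :: "'b set" and g
    using that by (induction A rule: infinite_finite_induct) (auto intro: m_closed one_closed)
  have pow_closed: "p ^ n \<in> carrier ?R" if "p \<in> carrier ?R" for p n
    using that by (induction n) (auto intro: m_closed one_closed)
  have Const_closed: "Const c \<in> carrier ?R" for c
    by (simp add: poly_ring_def Const_def)
  have Var_closed: "Var v \<in> carrier ?R" if "v \<in> verts G" for v
    using that by (simp add: poly_ring_def Var_def)
  fix p q :: "('v set, 'k) mpoly"
  assume p: "p \<in> carrier (poly_ring (edges G))"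
  show "toric_hom p \<in> carrier ?R"
    unfolding toric_hom_def poly_subst_def
  proof (intro sum_closed m_closed Const_closed prod_closed pow_closed)
    fix m e v assume "m \<in> Poly_Mapping.keys p" "e \<in> Poly_Mapping.keys m" "v \<in> e"
    then have "v \<in> verts G" using p assms by (fastforce simp: poly_ring_def simple_graph_def)
    then show "Var v \<in> carrier ?R" by (rule Var_closed)
  qed
next
  have "toric_hom (Const 1) = (Const 1 :: ('v, 'k) mpoly)"
    by (simp add: toric_hom_def)
  then show "toric_hom \<one>\<^bsub>poly_ring (edges G)\<^esub> = \<one>\<^bsub>poly_ring (verts G) :: ('v, 'k) mpoly ring\<^esub>"
    by (simp add: poly_ring_def Const_def)
qed (simp_all add: poly_ring_def toric_hom_def poly_subst_add poly_subst_mult)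

end

theory Submission
  imports Defs
begin

text \<open>The toric ideal is spanned by the binomials \<open>x\<^sup>a - x\<^sup>b\<close> for which \<open>a\<close> and \<open>b\<close> have the same
  vertex degrees. Write \<open>a = a1 + a2\<close> and \<open>b = b1 + b2\<close>, where \<open>a1\<close>, \<open>b1\<close> use edges of \<open>G1\<close>
  (including \<open>e\<close>) and \<open>a2\<close>, \<open>b2\<close> use the remaining edges. The degrees of \<open>a1\<close> and \<open>b1\<close> agree
  outside the two endpoints of \<open>e\<close>. As \<open>G1\<close> is bipartite, the degrees of \<open>a1\<close> have the same
  sum over both sides, and so do those of \<open>b1\<close>; hence the degrees differ by the same number
  \<open>d\<close> at both endpoints of \<open>e\<close>. If \<open>d \<ge> 0\<close>, then
  \<open>x\<^sup>a - x\<^sup>b = x\<^sup>a\<^sup>2 (x\<^sup>a\<^sup>1 - x\<^sup>b\<^sup>1 e\<^sup>d) + x\<^sup>b\<^sup>1 (x\<^sup>a\<^sup>2 e\<^sup>d - x\<^sup>b\<^sup>2)\<close>, where the two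
  binomials in brackets lie in the toric ideals of \<open>G1\<close> and \<open>G2\<close>.\<close>

section \<open>Degrees of edge monomials\<close>

text \<open>Exponent vector of the image of the monomial \<open>m\<close> under
  \<open>toric_hom\<close>. It is a \<open>poly_mapping\<close> rather than a plain function so that
  it can serve as a monomial itself.\<close>

definition vertex_degree :: "('v set \<Rightarrow>\<^sub>0 nat) \<Rightarrow> 'v \<Rightarrow>\<^sub>0 nat" where
  "vertex_degree m = (\<Sum>e \<in> Poly_Mapping.keys m.
     \<Sum>v\<in>e. Poly_Mapping.single v (Poly_Mapping.lookup m e))"

lemma vertex_degree_superset:
  assumes "finite S" "Poly_Mapping.keys m \<subseteq> S"
  shows "vertex_degree m = (\<Sum>e\<in>S. \<Sum>v\<in>e. Poly_Mapping.single v (Poly_Mapping.lookup m e))"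
  unfolding vertex_degree_def
  by (rule sum.mono_neutral_left) (use assms in \<open>auto simp: in_keys_iff\<close>)

lemma vertex_degree_add: "vertex_degree (a + b) = vertex_degree a + vertex_degree b"
proof -
  let ?S = "Poly_Mapping.keys a \<union> Poly_Mapping.keys b"
  have "Poly_Mapping.keys (a + b) \<subseteq> ?S" by (rule Poly_Mapping.keys_add)
  then show ?thesis
    by (simp add: vertex_degree_superset[of ?S] lookup_add single_add sum.distrib)
qed

lemma vertex_degree_single:
  "vertex_degree (Poly_Mapping.single e n) = (\<Sum>v\<in>e. Poly_Mapping.single v n)"
  by (simp add: vertex_degree_def)

lemma lookup_sum_single:
  "finite e \<Longrightarrow> Poly_Mapping.lookup (\<Sum>v\<in>e. Poly_Mapping.single v n) u = (n when u \<in> e)"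
  by (simp add: lookup_sum lookup_single when_def)

lemma lookup_vertex_degree_eq_0:
  assumes "\<And>e. e \<in> Poly_Mapping.keys m \<Longrightarrow> v \<notin> e"
  shows "Poly_Mapping.lookup (vertex_degree m) v = 0"
  unfolding vertex_degree_def lookup_sum lookup_single
  by (rule sum.neutral, rule ballI, rule sum.neutral) (use assms in \<open>auto simp: when_def\<close>)

text \<open>Double counting: each edge in \<open>m\<close> has exactly one endpoint in
  \<open>A\<close>, so it contributes its multiplicity exactly once to the degree sum.\<close>

lemma sum_vertex_degree:
  assumes "finite A" "\<And>e. e \<in> Poly_Mapping.keys m \<Longrightarrow> \<exists>a. a \<in> A \<and> e \<inter> A = {a} \<and> finite e"
  shows "(\<Sum>v\<in>A. Poly_Mapping.lookup (vertex_degree m) v) =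
    (\<Sum>e \<in> Poly_Mapping.keys m. Poly_Mapping.lookup m e)"
proof -
  have "(\<Sum>v\<in>A. Poly_Mapping.lookup (vertex_degree m) v) = (\<Sum>e \<in> Poly_Mapping.keys m. \<Sum>v\<in>A.
      Poly_Mapping.lookup (\<Sum>v\<in>e. Poly_Mapping.single v (Poly_Mapping.lookup m e)) v)"
    unfolding vertex_degree_def lookup_sum[where X = "Poly_Mapping.keys m"] by (rule sum.swap)
  also have "\<dots> = (\<Sum>e \<in> Poly_Mapping.keys m. Poly_Mapping.lookup m e)"
  proof (rule sum.cong[OF refl])
    fix e assume "e \<in> Poly_Mapping.keys m"
    then obtain a where a: "a \<in> A" "e \<inter> A = {a}" "finite e" using assms(2) by blast
    then have "v \<in> e \<longleftrightarrow> v = a" if "v \<in> A" for v using that by blast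
    then show "(\<Sum>v\<in>A. Poly_Mapping.lookup (\<Sum>v\<in>e. Poly_Mapping.single v (Poly_Mapping.lookup m e)) v) =
        Poly_Mapping.lookup m e"
      using a assms(1) by (simp add: lookup_sum_single when_def cong: sum.cong)
  qed
  finally show ?thesis .
qed

text \<open>Both sums count the edges of \<open>m\<close> with multiplicity, since every edge has
  one endpoint on each side.\<close>

lemma bipartite_sum_vertex_degree:
  assumes "finite (verts G)" "A \<union> B = verts G" "A \<inter> B = {}"
    and "\<forall>e\<in>edges G. \<exists>a\<in>A. \<exists>b\<in>B. e = {a, b}"
    and "Poly_Mapping.keys m \<subseteq> edges G"
  shows "(\<Sum>v\<in>A. Poly_Mapping.lookup (vertex_degree m) v) =
    (\<Sum>v\<in>B. Poly_Mapping.lookup (vertex_degree m) v)"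
proof -
  have "finite A" "finite B" using assms(1) by (auto simp flip: assms(2))
  have *: "\<exists>a b. a \<in> A \<and> b \<in> B \<and> e \<inter> A = {a} \<and> e \<inter> B = {b} \<and> e = {a, b}"
    if "e \<in> Poly_Mapping.keys m" for e
  proof -
    from that assms(5) have "e \<in> edges G" by blast
    with assms(4) obtain a b where ab: "a \<in> A" "b \<in> B" and e: "e = {a, b}" by metis
    have "e \<inter> A = {a}" "e \<inter> B = {b}" using ab assms(3) unfolding e by blast+
    then show ?thesis using ab e by blast
  qed
  have "(\<Sum>v\<in>A. Poly_Mapping.lookup (vertex_degree m) v) =
      (\<Sum>e \<in> Poly_Mapping.keys m. Poly_Mapping.lookup m e)"
    by (rule sum_vertex_degree[OF \<open>finite A\<close>]) (use * in fastforce)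
  also have "\<dots> = (\<Sum>v\<in>B. Poly_Mapping.lookup (vertex_degree m) v)"
    by (rule sum_vertex_degree[OF \<open>finite B\<close>, symmetric]) (use * in fastforce)
  finally show ?thesis .
qed

lemma single_sum: "Poly_Mapping.single k (sum f A) = (\<Sum>x\<in>A. Poly_Mapping.single k (f x))"
  by (induction A rule: infinite_finite_induct) (simp_all add: single_add)

text \<open>Used to factor a monomial into its part supported on the edges of \<open>G1\<close> and
  the remaining part.\<close>

lemma poly_mapping_split:
  fixes m :: "'a \<Rightarrow>\<^sub>0 'b::comm_monoid_add"
  obtains m1 m2 where "m = m1 + m2" "Poly_Mapping.keys m1 \<subseteq> Poly_Mapping.keys m \<inter> S"
    "Poly_Mapping.keys m2 \<subseteq> Poly_Mapping.keys m - S"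
proof
  let ?f = "\<lambda>x. Poly_Mapping.single x (Poly_Mapping.lookup m x)"
  show "m = (\<Sum>x \<in> Poly_Mapping.keys m \<inter> S. ?f x) + (\<Sum>x \<in> Poly_Mapping.keys m - S. ?f x)"
    by (rule poly_mapping_eqI)
      (auto simp: lookup_add lookup_sum lookup_single when_def in_keys_iff)
  show "Poly_Mapping.keys (\<Sum>x \<in> Poly_Mapping.keys m \<inter> S. ?f x) \<subseteq> Poly_Mapping.keys m \<inter> S"
    by (rule order_trans[OF keys_sum]) auto
  show "Poly_Mapping.keys (\<Sum>x \<in> Poly_Mapping.keys m - S. ?f x) \<subseteq> Poly_Mapping.keys m - S"
    by (rule order_trans[OF keys_sum]) auto
qed

section \<open>Binomials in the toric ideal\<close>

lemma Var_power: "Var v ^ n = Poly_Mapping.single (Poly_Mapping.single v n) 1"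
  by (induction n) (simp_all add: Var_def mult_single flip: single_add)

lemma prod_single:
  "(\<Prod>x\<in>A. Poly_Mapping.single (f x) 1) =
    (Poly_Mapping.single (\<Sum>x\<in>A. f x) 1 :: 'a::comm_monoid_add \<Rightarrow>\<^sub>0 'k::comm_semiring_1)"
  by (induction A rule: infinite_finite_induct) (simp_all add: mult_single)

lemma toric_hom_single:
  "toric_hom (Poly_Mapping.single m c) = Poly_Mapping.single (vertex_degree m) c"
  by (simp add: toric_hom_def poly_subst_single prod_power_distrib Var_power prod_single
      Const_def mult_single flip: vertex_degree_def)

lemma toric_hom_diff: "toric_hom (p - q) = toric_hom p - toric_hom q"
  using poly_subst_add[of "\<lambda>e. \<Prod>v\<in>e. Var v" "p - q" q] by (simp add: toric_hom_def eq_diff_eq)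

lemma mem_toric_ideal_iff:
  "p \<in> toric_ideal G \<longleftrightarrow>
    (\<forall>m \<in> Poly_Mapping.keys p. Poly_Mapping.keys m \<subseteq> edges G) \<and> toric_hom p = 0"
  by (simp add: toric_ideal_def a_kernel_def' poly_ring_def)

lemma toric_ideal_subset_carrier: "toric_ideal G \<subseteq> carrier (poly_ring (edges G))"
  by (fastforce simp: mem_toric_ideal_iff poly_ring_def)

lemma toric_ideal_mono: "edges H \<subseteq> edges G \<Longrightarrow> toric_ideal H \<subseteq> toric_ideal G"
  by (fastforce simp: mem_toric_ideal_iff)

lemma ideal_toric_ideal:
  assumes "simple_graph G"
  shows "ideal (toric_ideal G :: ('v set, 'k::comm_ring_1) mpoly set) (poly_ring (edges G))"
proof -
  interpret E: cring "poly_ring (edges G) :: ('v set, 'k) mpoly ring" by (rule cring_poly_ring)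
  interpret V: cring "poly_ring (verts G) :: ('v, 'k) mpoly ring" by (rule cring_poly_ring)
  interpret ring_hom_ring "poly_ring (edges G) :: ('v set, 'k) mpoly ring" "poly_ring (verts G)"
    toric_hom
    by (intro ring_hom_ringI2 toric_hom_ring_hom assms E.ring_axioms V.ring_axioms)
  show ?thesis unfolding toric_ideal_def by (rule kernel_is_ideal)
qed

lemma binomial_mem_toric_ideal:
  assumes "Poly_Mapping.keys a \<subseteq> edges G" "Poly_Mapping.keys b \<subseteq> edges G"
    and "vertex_degree a = vertex_degree b"
  shows "Poly_Mapping.single a c - Poly_Mapping.single b c \<in> toric_ideal G"
proof -
  have "Poly_Mapping.keys (Poly_Mapping.single a c - Poly_Mapping.single b c) \<subseteq> {a, b}"
    by (rule order_trans[OF keys_diff]) auto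
  then show ?thesis
    using assms by (auto simp: mem_toric_ideal_iff toric_hom_diff toric_hom_single)
qed

text \<open>Transfers the ideal axioms from the record operations of \<open>poly_ring\<close> to the
  type class operations, in which the binomial identities are computed. Multiplication by single
  terms suffices for them.\<close>

lemma poly_ring_ideal_closed:
  fixes I :: "('x, 'k::comm_ring_1) mpoly set"
  assumes "ideal I (poly_ring X)"
  shows "0 \<in> I" "\<And>p q. p \<in> I \<Longrightarrow> q \<in> I \<Longrightarrow> p + q \<in> I"
    and "\<And>a c p. Poly_Mapping.keys a \<subseteq> X \<Longrightarrow> p \<in> I \<Longrightarrow> Poly_Mapping.single a c * p \<in> I"
    and "\<And>p. p \<in> I \<Longrightarrow> - p \<in> I"
proof -
  interpret ideal I "poly_ring X" by (rule assms)
  show "0 \<in> I" using additive_subgroup.zero_closed[OF is_additive_subgroup] by (simp add: poly_ring_def)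
  show "p + q \<in> I" if "p \<in> I" "q \<in> I" for p q
    using additive_subgroup.a_closed[OF is_additive_subgroup that] by (simp add: poly_ring_def)
  show *: "Poly_Mapping.single a c * p \<in> I" if "Poly_Mapping.keys a \<subseteq> X" "p \<in> I" for a c p
    using I_l_closed[OF that(2), of "Poly_Mapping.single a c"] that(1)
    by (simp add: poly_ring_def)
  show "- p \<in> I" if "p \<in> I" for p
    using *[of 0 p "-1"] that by (simp add: single_uminus)
qed

text \<open>A monomial goes to a monomial determined by its vertex degrees, so a polynomial is in
  the kernel exactly when its coefficients add up to zero over each class of monomials of equal
  degree. Comparing every monomial with one representative of its class then writes the polynomial
  as a sum of binomials.\<close>

lemma toric_ideal_subset_idealI:
  fixes I :: "('v set, 'k::comm_ring_1) mpoly set"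
  assumes I: "ideal I (poly_ring (edges G))"
    and binomial: "\<And>a b c. Poly_Mapping.keys a \<subseteq> edges G \<Longrightarrow> Poly_Mapping.keys b \<subseteq> edges G \<Longrightarrow>
      vertex_degree a = vertex_degree b \<Longrightarrow>
      Poly_Mapping.single a c - Poly_Mapping.single b c \<in> I"
  shows "toric_ideal G \<subseteq> I"
proof
  fix p :: "('v set, 'k) mpoly" assume "p \<in> toric_ideal G"
  then have p: "\<And>m. m \<in> Poly_Mapping.keys p \<Longrightarrow> Poly_Mapping.keys m \<subseteq> edges G"
    and p0: "toric_hom p = 0" by (auto simp: mem_toric_ideal_iff)
  let ?K = "Poly_Mapping.keys p" and ?c = "Poly_Mapping.lookup p"
  \<comment> \<open>On degrees that occur in \<open>p\<close>, \<open>r\<close> selects a monomial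
    of \<open>p\<close> having that degree.\<close>
  define r where "r = inv_into ?K vertex_degree"
  have r: "r (vertex_degree m) \<in> ?K" "vertex_degree (r (vertex_degree m)) = vertex_degree m"
    if "m \<in> ?K" for m
    using that by (auto simp: r_def intro: inv_into_into f_inv_into_f)
  have "toric_hom (\<Sum>m\<in>?K. Poly_Mapping.single m (?c m)) = (0 :: ('v, 'k) mpoly)"
    using p0 mpoly_sum_single[of p] by simp
  then have deg0: "(\<Sum>m\<in>?K. Poly_Mapping.single (vertex_degree m) (?c m)) = 0"
    by (simp add: toric_hom_def poly_subst_sum flip: toric_hom_single)
  \<comment> \<open>This fibre sum is the coefficient of \<open>toric_hom p\<close> at
    \<open>s\<close>.\<close>
  have coeff: "(\<Sum>m | m \<in> ?K \<and> vertex_degree m = s. ?c m) = 0" for s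
  proof -
    have "Poly_Mapping.lookup (\<Sum>m\<in>?K. Poly_Mapping.single (vertex_degree m) (?c m)) s = 0"
      unfolding deg0 by simp
    then show ?thesis
      by (simp add: lookup_sum lookup_single when_def sum.inter_filter)
  qed
  \<comment> \<open>Grouped by degree, the coefficients collected at each representative cancel, so
    subtracting all representatives leaves \<open>p\<close> unchanged.\<close>
  have "(\<Sum>m\<in>?K. Poly_Mapping.single (r (vertex_degree m)) (?c m)) =
      (\<Sum>s \<in> vertex_degree ` ?K. \<Sum>m | m \<in> ?K \<and> vertex_degree m = s.
        Poly_Mapping.single (r (vertex_degree m)) (?c m))"
    by (rule sum.image_gen) simp
  also have "\<dots> = (\<Sum>s \<in> vertex_degree ` ?K.
      Poly_Mapping.single (r s) (\<Sum>m | m \<in> ?K \<and> vertex_degree m = s. ?c m))"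
    by (rule sum.cong[OF refl]) (simp add: single_sum)
  also have "\<dots> = 0" by (simp add: coeff)
  finally have "p = (\<Sum>m\<in>?K. Poly_Mapping.single m (?c m) -
      Poly_Mapping.single (r (vertex_degree m)) (?c m))"
    by (simp add: sum_subtractf flip: mpoly_sum_single)
  also have "\<dots> \<in> I"
  proof -
    have "sum f S \<in> I" if "\<And>m. m \<in> S \<Longrightarrow> f m \<in> I" for f and S :: "('v set \<Rightarrow>\<^sub>0 nat) set"
      using that by (induction S rule: infinite_finite_induct)
        (auto intro: poly_ring_ideal_closed[OF I])
    then show ?thesis using p r binomial by simp
  qed
  finally show "p \<in> I" .
qed

section \<open>Splitting along an edge\<close>

text \<open>Formulated for an arbitrary ideal containing both toric ideals, so that the argument can
  ignore how extended ideals and their sum are constructed.\<close>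

lemma binomial_mem_of_splitting_along_edge:
  fixes G G1 G2 :: "'v ugraph" and I :: "('v set, 'k::comm_ring_1) mpoly set"
  assumes G: "simple_graph G" and split: "splitting_along_edge G G1 G2 e" and "bipartite G1"
    and I: "ideal I (poly_ring (edges G))" "toric_ideal G1 \<subseteq> I" "toric_ideal G2 \<subseteq> I"
    and a: "Poly_Mapping.keys a \<subseteq> edges G" and b: "Poly_Mapping.keys b \<subseteq> edges G"
    and deg: "vertex_degree a = vertex_degree b"
  shows "Poly_Mapping.single a c - Poly_Mapping.single b c \<in> I"
proof -
  note closed = poly_ring_ideal_closed[OF I(1)]
  from split obtain W1 W2 where "e \<in> edges G" and W: "W1 \<union> W2 = verts G"
    and G1: "G1 = induced G W1" and G2: "G2 = induced G W2"
    and H: "\<lparr>verts = e, edges = {e}\<rparr> = induced G (W1 \<inter> W2)"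
    and sep: "\<forall>u \<in> W1 - W1 \<inter> W2. \<forall>w \<in> W2 - W1 \<inter> W2. {u, w} \<notin> edges G"
    unfolding splitting_along_edge_def splitting_along_def by blast
  from H have "W1 \<inter> W2 = e" by (simp add: induced_def)
  with \<open>e \<in> edges G\<close> have e: "e \<in> edges G" "W1 \<inter> W2 = e" by simp_all
  have "finite (verts G)" using G by (simp add: simple_graph_def)
  then have "finite W1" unfolding W[symmetric] by simp
  have verts1: "verts G1 = W1" by (simp add: G1 induced_def)
  have edges_G: "f \<subseteq> W1 \<or> f \<subseteq> W2" if "f \<in> edges G" for f
  proof -
    from that G have f: "card f = 2" "f \<subseteq> W1 \<union> W2" by (simp_all add: simple_graph_def W)
    then obtain x y where xy: "f = {x, y}" by (auto simp: card_2_iff)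
    \<comment> \<open>The separation hypothesis fixes which endpoint lies on the \<open>W1\<close>
      side, so both orders are needed.\<close>
    then have "{x, y} \<in> edges G" "{y, x} \<in> edges G" using that by (simp_all add: insert_commute)
    then show ?thesis using sep f(2) unfolding xy by blast
  qed
  have edges1: "edges G1 = {f \<in> edges G. f \<subseteq> W1}" and edges2: "edges G2 = {f \<in> edges G. f \<subseteq> W2}"
    by (simp_all add: G1 G2 induced_def)
  have e1: "e \<in> edges G1" and e2: "e \<in> edges G2" using e by (auto simp: edges1 edges2)
  from \<open>bipartite G1\<close> obtain A B where AB: "A \<union> B = verts G1" "A \<inter> B = {}"
    "\<forall>f\<in>edges G1. \<exists>x\<in>A. \<exists>y\<in>B. f = {x, y}" unfolding bipartite_def by blast
  with e1 obtain u w where uw: "u \<in> A" "w \<in> B" "e = {u, w}" by blast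
  have "finite (A \<union> B)" using \<open>finite W1\<close> by (simp add: AB(1) verts1)
  then have "finite A" "finite B" by simp_all
  have "u \<noteq> w" using uw AB(2) by blast

  text \<open>The two cases for the sign of \<open>d\<close> are symmetric in \<open>a\<close> and \<open>b\<close>.\<close>
  have main: "Poly_Mapping.single (a1 + a2) c - Poly_Mapping.single (b1 + b2) c \<in> I"
    if a1: "Poly_Mapping.keys a1 \<subseteq> edges G1" and a2: "Poly_Mapping.keys a2 \<subseteq> edges G - edges G1"
      and b1: "Poly_Mapping.keys b1 \<subseteq> edges G1" and b2: "Poly_Mapping.keys b2 \<subseteq> edges G - edges G1"
      and deg: "vertex_degree (a1 + a2) = vertex_degree (b1 + b2)"
      and le: "Poly_Mapping.lookup (vertex_degree b1) u \<le> Poly_Mapping.lookup (vertex_degree a1) u"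
    for a1 a2 b1 b2 c
  proof -
    let ?D = "\<lambda>m. Poly_Mapping.lookup (vertex_degree m)"
    \<comment> \<open>The subtraction of natural numbers does not truncate, because of
      \<open>le\<close>.\<close>
    define d where "d = ?D a1 u - ?D b1 u"
    define ed where "ed = Poly_Mapping.single e d"
    have deg_ed: "?D ed v = (d when v \<in> e)" for v
      using uw by (simp add: ed_def vertex_degree_single lookup_sum_single)
    have rest_G2: "edges G - edges G1 \<subseteq> edges G2"
      using edges_G by (auto simp: edges1 edges2)
    have rest: "?D m v = 0" if "Poly_Mapping.keys m \<subseteq> edges G - edges G1" "v \<notin> W2" for m v
      by (rule lookup_vertex_degree_eq_0) (use that rest_G2 in \<open>auto simp: edges2\<close>)
    \<comment> \<open>Edges outside \<open>G1\<close> lie in \<open>G2\<close> and miss such a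
      vertex, so its whole degree comes from \<open>a1\<close> and \<open>b1\<close>.\<close>
    have W1_W2: "?D a1 v = ?D b1 v" if "v \<notin> W2" for v
      using arg_cong[OF deg, of "\<lambda>f. Poly_Mapping.lookup f v"] rest[OF a2 that] rest[OF b2 that]
      by (simp add: vertex_degree_add lookup_add)
    have in_W1: "?D m v = 0" if "Poly_Mapping.keys m \<subseteq> edges G1" "v \<notin> W1" for m v
      by (rule lookup_vertex_degree_eq_0) (use that in \<open>auto simp: edges1\<close>)
    \<comment> \<open>A vertex outside \<open>e\<close> misses \<open>W2\<close>, where
      \<open>W1_W2\<close> applies, or misses \<open>W1\<close>, where both degrees vanish.\<close>
    have off: "?D a1 v = ?D b1 v" if "v \<notin> e" for v
      using W1_W2[of v] in_W1[OF a1, of v] in_W1[OF b1, of v] that e(2) by auto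
    have bal: "(\<Sum>v\<in>A. ?D m v) = (\<Sum>v\<in>B. ?D m v)" if "Poly_Mapping.keys m \<subseteq> edges G1" for m
      using \<open>finite W1\<close> AB that
      by (intro bipartite_sum_vertex_degree[of G1]) (simp_all add: verts1)
    have endpoints: "?D m u + (\<Sum>v\<in>A - {u}. ?D m v) = ?D m w + (\<Sum>v\<in>B - {w}. ?D m v)"
      if "Poly_Mapping.keys m \<subseteq> edges G1" for m
      using bal[OF that] sum.remove[OF \<open>finite A\<close> uw(1), of "?D m"]
        sum.remove[OF \<open>finite B\<close> uw(2), of "?D m"] by linarith
    moreover have "(\<Sum>v\<in>A - {u}. ?D a1 v) = (\<Sum>v\<in>A - {u}. ?D b1 v)"
      "(\<Sum>v\<in>B - {w}. ?D a1 v) = (\<Sum>v\<in>B - {w}. ?D b1 v)"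
      using uw AB(2) by (auto intro!: sum.cong off)
    \<comment> \<open>Comparing the balance equations of \<open>a1\<close> and \<open>b1\<close>
      leaves only the endpoints of \<open>e\<close>. The additive form avoids truncated
      subtraction.\<close>
    ultimately have "?D a1 w + ?D b1 u = ?D b1 w + ?D a1 u"
      using endpoints[OF a1] endpoints[OF b1] by linarith
    then have "?D a1 w = ?D b1 w + d" "?D a1 u = ?D b1 u + d"
      using le by (simp_all add: d_def)
    then have deg1: "vertex_degree a1 = vertex_degree (b1 + ed)"
      using off uw(3)
      by (intro poly_mapping_eqI) (auto simp: vertex_degree_add lookup_add deg_ed when_def)
    \<comment> \<open>Adding \<open>vertex_degree b1\<close> to both sides reduces the claim for the
      \<open>G2\<close> parts to the given equality of total degrees; it is cancelled next.\<close>
    with deg have "vertex_degree b1 + vertex_degree (a2 + ed) = vertex_degree b1 + vertex_degree b2"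
      by (simp add: vertex_degree_add add_ac)
    then have deg2: "vertex_degree (a2 + ed) = vertex_degree b2" by (simp only: add_left_cancel)
    have keys_ed: "Poly_Mapping.keys ed \<subseteq> {e}" by (simp add: ed_def)
    have "Poly_Mapping.single a1 c - Poly_Mapping.single (b1 + ed) c \<in> toric_ideal G1"
      using a1 b1 e1 keys_ed Poly_Mapping.keys_add[of b1 ed]
      by (intro binomial_mem_toric_ideal deg1) blast+
    moreover have "Poly_Mapping.single (a2 + ed) c - Poly_Mapping.single b2 c \<in> toric_ideal G2"
      using a2 b2 e2 keys_ed rest_G2 Poly_Mapping.keys_add[of a2 ed]
      by (intro binomial_mem_toric_ideal deg2) blast+
    moreover have "Poly_Mapping.keys a2 \<subseteq> edges G" "Poly_Mapping.keys b1 \<subseteq> edges G"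
      using a2 b1 by (auto simp: edges1)
    \<comment> \<open>The two cross terms, both with exponent \<open>a2 + b1 + ed\<close>, cancel
      and leave the required binomial.\<close>
    ultimately have "Poly_Mapping.single a2 1 *
          (Poly_Mapping.single a1 c - Poly_Mapping.single (b1 + ed) c) +
        Poly_Mapping.single b1 1 *
          (Poly_Mapping.single (a2 + ed) c - Poly_Mapping.single b2 c) \<in> I"
      using I(2,3) by (intro closed) auto
    then show ?thesis
      by (simp add: right_diff_distrib mult_single add_ac)
  qed

  obtain a1 a2 where A: "a = a1 + a2" "Poly_Mapping.keys a1 \<subseteq> Poly_Mapping.keys a \<inter> edges G1"
    "Poly_Mapping.keys a2 \<subseteq> Poly_Mapping.keys a - edges G1" by (rule poly_mapping_split)
  obtain b1 b2 where B: "b = b1 + b2" "Poly_Mapping.keys b1 \<subseteq> Poly_Mapping.keys b \<inter> edges G1"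
    "Poly_Mapping.keys b2 \<subseteq> Poly_Mapping.keys b - edges G1" by (rule poly_mapping_split)
  have keys: "Poly_Mapping.keys a1 \<subseteq> edges G1" "Poly_Mapping.keys a2 \<subseteq> edges G - edges G1"
    "Poly_Mapping.keys b1 \<subseteq> edges G1" "Poly_Mapping.keys b2 \<subseteq> edges G - edges G1"
    using A B a b by auto
  show ?thesis
  proof (cases "Poly_Mapping.lookup (vertex_degree b1) u \<le> Poly_Mapping.lookup (vertex_degree a1) u")
    case True
    then show ?thesis using main[OF keys] deg by (simp add: A(1) B(1))
  next
    case False
    \<comment> \<open>With the roles of \<open>a\<close> and \<open>b\<close> exchanged, the
      binomial appears with the opposite sign.\<close>
    then have "Poly_Mapping.single b c - Poly_Mapping.single a c \<in> I"
      using main[OF keys(3,4,1,2)] deg by (simp add: A(1) B(1))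
    from closed(4)[OF this] show ?thesis by simp
  qed
qed

theorem corollary4p8:
  fixes G G1 G2 :: "'v ugraph" and e :: "'v set"
  assumes "simple_graph G"
    and "splitting_along_edge G G1 G2 e"
    and "bipartite G1"
  shows "(toric_ideal G :: ('v set, 'k::{alg_closed_field, field_char_0}) mpoly set) =
    toric_ideal_in G G1 <+>\<^bsub>poly_ring (edges G)\<^esub> toric_ideal_in G G2"
proof
  let ?R = "poly_ring (edges G) :: ('v set, 'k) mpoly ring"
  let ?T = "toric_ideal :: 'v ugraph \<Rightarrow> ('v set, 'k) mpoly set"
  let ?J1 = "toric_ideal_in G G1 :: ('v set, 'k) mpoly set"
  let ?J2 = "toric_ideal_in G G2 :: ('v set, 'k) mpoly set"
  interpret cring ?R by (rule cring_poly_ring)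
  have sub: "edges G1 \<subseteq> edges G" "edges G2 \<subseteq> edges G"
    using assms(2) by (auto simp: splitting_along_edge_def splitting_along_def induced_def)
  have T: "?T G1 \<subseteq> ?T G" "?T G2 \<subseteq> ?T G" using sub by (auto intro!: toric_ideal_mono)
  then have carr: "?T G1 \<subseteq> carrier ?R" "?T G2 \<subseteq> carrier ?R"
    using toric_ideal_subset_carrier by blast+
  have J: "ideal ?J1 ?R" "ideal ?J2 ?R"
    unfolding toric_ideal_in_def by (intro genideal_ideal carr)+
  have TJ: "?T G1 \<subseteq> ?J1" "?T G2 \<subseteq> ?J2"
    unfolding toric_ideal_in_def by (intro genideal_self carr)+
  have sum_eq: "?J1 <+>\<^bsub>?R\<^esub> ?J2 = {p + q | p q. p \<in> ?J1 \<and> q \<in> ?J2}"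
    by (auto simp: set_add_def' poly_ring_def)
  show "?J1 <+>\<^bsub>?R\<^esub> ?J2 \<subseteq> ?T G"
  proof -
    \<comment> \<open>Each extension is the smallest ideal containing its generators, and
      \<open>?T G\<close> is an ideal containing them.\<close>
    have "?J1 \<subseteq> ?T G" "?J2 \<subseteq> ?T G"
      unfolding toric_ideal_in_def by (intro genideal_minimal ideal_toric_ideal assms(1) T)+
    then show ?thesis
      using poly_ring_ideal_closed(2)[OF ideal_toric_ideal[OF assms(1)]] by (auto simp: sum_eq)
  qed
  \<comment> \<open>Take zero as the other summand.\<close>
  have "?J1 \<subseteq> ?J1 <+>\<^bsub>?R\<^esub> ?J2" "?J2 \<subseteq> ?J1 <+>\<^bsub>?R\<^esub> ?J2"
    unfolding sum_eq using poly_ring_ideal_closed(1)[OF J(1)] poly_ring_ideal_closed(1)[OF J(2)]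
    by force+
  with TJ have TJ': "?T G1 \<subseteq> ?J1 <+>\<^bsub>?R\<^esub> ?J2" "?T G2 \<subseteq> ?J1 <+>\<^bsub>?R\<^esub> ?J2" by blast+
  \<comment> \<open>The sum of the two extensions is an ideal containing both toric ideals, so it
    can play the role of \<open>I\<close>.\<close>
  show "?T G \<subseteq> ?J1 <+>\<^bsub>?R\<^esub> ?J2"
    by (rule toric_ideal_subset_idealI[OF add_ideals[OF J]],
        rule binomial_mem_of_splitting_along_edge[OF assms add_ideals[OF J] TJ'])
qed

end
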